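(* Let $a,c\in\mathbb R$ be nonzero and let $S\subset\mathbb R^3$ be the Dupin cyclide of Type I (torus) in canonical form, i.e. the zero set of $$(x^2+y^2+z^2+a^2-c^2)^2-4a^2(x^2+y^2),$$ with spine curves and radius functions $$\mathbf c_1(t)=a\Big(\tfrac{1-t^2}{1+t^2},\tfrac{2t}{1+t^2},0\Big),\quad r_1(t)=c,\qquad \mathbf c_2(t)=a\Big(0,0,\tfrac{2t}{1-t^2}\Big),\quad r_2(t)=c-a\tfrac{1+t^2}{1-t^2}.$$ An isometry $\mathbf f(\mathbf x)=\mathbf Q\mathbf x+\mathbf b$ of $\mathbb R^3$ is a symmetry of $S$ (i.e. $\mathbf f(S)=S$) if and only if there exist Möbius transformations $\varphi_1,\varphi_2$ such that (A1) $\mathbf f\circ\mathbf c_1=\mathbf c_1\circ\varphi_1$ and $\mathbf f\circ\mathbf c_2=\mathbf c_2\circ\varphi_2$, and (A2) $r_1^2=(r_1\circ\varphi_1)^2$ and $r_2^2=(r_2\circ\varphi_2)^2$. Moreover, these Möbius transformations take the form $$\varphi_1(t)=-\left(\frac{\cos(\theta/2)\,t+\sin(\theta/2)}{\sin(\theta/2)\,t-\cos(\theta/2)}\right)^{\varepsilon_2},\qquad \varphi_2(t)=\varepsilon_1t,$$ with signs $\varepsilon_1,\varepsilon_2\in\{-1,1\}$ and angle $\theta\in[0,2\pi)$, with associated symmetries $$\mathbf f(\mathbf x)=\mathbf Q\mathbf x,\qquad \mathbf Q=\begin{pmatrix}\varepsilon_2\cos\theta&-\varepsilon_2\sin\theta&0\\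 \sin\theta&\cos\theta&0\\0&0&\varepsilon_1\end{pmatrix},$$ and these form a symmetry group isomorphic to $\mathbb Z_2\times G$, where $G\subset O(3)$ is the subgroup consisting of the rotations about the $z$-axis and the reflections in planes containing the $z$-axis.
   Context: A Möbius transformation is a real rational function $\varphi(t)=\frac{\alpha t+\beta}{\gamma t+\delta}$ with real coefficients and $\alpha\delta-\beta\gamma\ne0$. An isometry of $\mathbb R^3$ is a map $\mathbf x\mapsto\mathbf Q\mathbf x+\mathbf b$ with $\mathbf Q$ orthogonal and $\mathbf b\in\mathbb R^3$. Identities between compositions are identities of rational functions. A pair $(\mathbf c_i,r_i)$ represents $S$ as the envelope of the spheres with center $\mathbf c_i(t)$ (spine curve) and radius $r_i(t)$ (radius function). *)

theory Defs
  imports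
    "HOL-Analysis.Analysis"
    "HOL-Computational_Algebra.Computational_Algebra"
    "HOL-Computational_Algebra.Field_as_Ring"
    "HOL-Algebra.Elementary_Groups"
begin

text \<open>
  Real rational functions in one variable are elements of the field
  \<^typ>\<open>real poly fract\<close>, so that an equation between them is an identity of rational functions.
\<close>

type_synonym ratfun = "real poly fract"

definition rf_const :: "real \<Rightarrow> ratfun" where
  "rf_const x = to_fract [:x:]"

definition rf_var :: ratfun where
  "rf_var = to_fract [:0, 1:]"

text \<open>
  Composition substitutes the second argument into the numerator and the denominator of the first.
  If the second argument is nonconstant (for instance a Moebius transformation), the resulting
  denominator is a nonzero rational function, so no division by zero occurs.
\<close>

definition rf_subst :: "real poly \<Rightarrow> ratfun \<Rightarrow> ratfun" where
  "rf_subst p \<phi> = poly (map_poly rf_const p) \<phi>"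

definition rf_comp :: "ratfun \<Rightarrow> ratfun \<Rightarrow> ratfun" where
  "rf_comp r \<phi> =
     (case quot_of_fract r of (p, q) \<Rightarrow> rf_subst p \<phi> / rf_subst q \<phi>)"

definition curve_comp :: "ratfun ^ 3 \<Rightarrow> ratfun \<Rightarrow> ratfun ^ 3" where
  "curve_comp u \<phi> = (\<chi> i. rf_comp (u $ i) \<phi>)"

definition moebius_ratfun :: "ratfun \<Rightarrow> bool" where
  "moebius_ratfun \<phi> \<longleftrightarrow> (\<exists>\<alpha> \<beta> \<gamma> \<delta> :: real. \<alpha> * \<delta> - \<beta> * \<gamma> \<noteq> 0 \<and>
     \<phi> = (rf_const \<alpha> * rf_var + rf_const \<beta>) / (rf_const \<gamma> * rf_var + rf_const \<delta>))"

definition affine_map :: "real ^ 3 ^ 3 \<Rightarrow> real ^ 3 \<Rightarrow> real ^ 3 \<Rightarrow> real ^ 3" where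
  "affine_map Q b x = Q *v x + b"

text \<open>The composition of \<^term>\<open>affine_map Q b\<close> with a rational curve.\<close>

definition affine_curve :: "real ^ 3 ^ 3 \<Rightarrow> real ^ 3 \<Rightarrow> ratfun ^ 3 \<Rightarrow> ratfun ^ 3" where
  "affine_curve Q b u = map_matrix rf_const Q *v u + (\<chi> i. rf_const (b $ i))"

definition torus_cyclide :: "real \<Rightarrow> real \<Rightarrow> (real ^ 3) set" where
  "torus_cyclide a c =
     {p. ((p $ 1)\<^sup>2 + (p $ 2)\<^sup>2 + (p $ 3)\<^sup>2 + a\<^sup>2 - c\<^sup>2)\<^sup>2 - 4 * a\<^sup>2 * ((p $ 1)\<^sup>2 + (p $ 2)\<^sup>2) = 0}"

definition spine1 :: "real \<Rightarrow> ratfun ^ 3" where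
  "spine1 a = rf_const a *s
     vector [(1 - rf_var\<^sup>2) / (1 + rf_var\<^sup>2), 2 * rf_var / (1 + rf_var\<^sup>2), 0]"

definition radius1 :: "real \<Rightarrow> ratfun" where
  "radius1 c = rf_const c"

definition spine2 :: "real \<Rightarrow> ratfun ^ 3" where
  "spine2 a = rf_const a *s vector [0, 0, 2 * rf_var / (1 - rf_var\<^sup>2)]"

definition radius2 :: "real \<Rightarrow> real \<Rightarrow> ratfun" where
  "radius2 a c = rf_const c - rf_const a * ((1 + rf_var\<^sup>2) / (1 - rf_var\<^sup>2))"

definition condA1 ::
    "real \<Rightarrow> real ^ 3 ^ 3 \<Rightarrow> real ^ 3 \<Rightarrow> ratfun \<Rightarrow> ratfun \<Rightarrow> bool" where
  "condA1 a Q b \<phi>1 \<phi>2 \<longleftrightarrow>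
     affine_curve Q b (spine1 a) = curve_comp (spine1 a) \<phi>1 \<and>
     affine_curve Q b (spine2 a) = curve_comp (spine2 a) \<phi>2"

definition condA2 :: "real \<Rightarrow> real \<Rightarrow> ratfun \<Rightarrow> ratfun \<Rightarrow> bool" where
  "condA2 a c \<phi>1 \<phi>2 \<longleftrightarrow>
     (radius1 c)\<^sup>2 = (rf_comp (radius1 c) \<phi>1)\<^sup>2 \<and>
     (radius2 a c)\<^sup>2 = (rf_comp (radius2 a c) \<phi>2)\<^sup>2"

definition phi1_form :: "int \<Rightarrow> real \<Rightarrow> ratfun" where
  "phi1_form \<epsilon>2 \<theta> =
     - (((rf_const (cos (\<theta> / 2)) * rf_var + rf_const (sin (\<theta> / 2))) /
         (rf_const (sin (\<theta> / 2)) * rf_var - rf_const (cos (\<theta> / 2)))) powi \<epsilon>2)"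

definition phi2_form :: "int \<Rightarrow> ratfun" where
  "phi2_form \<epsilon>1 = of_int \<epsilon>1 * rf_var"

definition Q_form :: "int \<Rightarrow> int \<Rightarrow> real \<Rightarrow> real ^ 3 ^ 3" where
  "Q_form \<epsilon>1 \<epsilon>2 \<theta> = vector
     [vector [of_int \<epsilon>2 * cos \<theta>, - of_int \<epsilon>2 * sin \<theta>, 0],
      vector [sin \<theta>, cos \<theta>, 0],
      vector [0, 0, of_int \<epsilon>1]]"

definition symmetry_group :: "(real ^ 3) set \<Rightarrow> (real ^ 3 \<Rightarrow> real ^ 3) monoid" where
  "symmetry_group S =
     \<lparr>carrier = {f. (\<exists>Q b. orthogonal_matrix Q \<and> f = affine_map Q b) \<and> f ` S = S},
      monoid.mult = (\<circ>), one = id\<rparr>"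

definition O3 :: "(real ^ 3 ^ 3) monoid" where
  "O3 = \<lparr>carrier = {Q. orthogonal_matrix Q}, monoid.mult = (**), one = mat 1\<rparr>"

definition z_rotations :: "(real ^ 3 ^ 3) set" where
  "z_rotations = {Q. rotation_matrix Q \<and> Q *v axis 3 1 = axis 3 1}"

text \<open>
  The reflection in the plane through the origin with unit normal \<open>n\<close>; this plane contains the
  \<open>z\<close>-axis if and only if \<open>n\<close> is orthogonal to \<^term>\<open>axis 3 1 :: real ^ 3\<close>.
\<close>

definition plane_reflection :: "real ^ 3 \<Rightarrow> real ^ 3 \<Rightarrow> real ^ 3" where
  "plane_reflection n x = x - (2 * (n \<bullet> x)) *\<^sub>R n"

definition z_reflections :: "(real ^ 3 ^ 3) set" where
  "z_reflections = {matrix (plane_reflection n) |n. norm n = 1 \<and> n \<bullet> axis 3 1 = 0}"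

definition z_subgroup :: "(real ^ 3 ^ 3) set" where
  "z_subgroup = z_rotations \<union> z_reflections"

end

theory Submission
  imports Defs
begin

text \<open>
  The equations for the spine curves pin an isometry down by comparing coefficients of rational
  functions. Up to the factor \<open>a\<close>, the curve \<open>c\<^sub>1\<close> is the stereographic parametrization
  \<open>(X, Y, 0)\<close> of the unit circle, and \<open>1\<close>, \<open>X\<close>, \<open>Y\<close> are linearly independent over
  the reals. So the third coordinate of \<open>Q c\<^sub>1 + b\<close> can vanish only if
  \<open>Q\<^sub>3\<^sub>1 = Q\<^sub>3\<^sub>2 = b\<^sub>3 = 0\<close>, and the first two coordinates of \<open>Q c\<^sub>2 + b\<close> can vanish
  only if \<open>b\<^sub>1 = b\<^sub>2 = 0\<close> (lemma \<open>condA1_imp_axis_preserving\<close>). An orthogonal matrix with such a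
  third row is one of the matrices \<open>Q_form \<epsilon>1 \<epsilon>2 \<theta>\<close>
  (\<open>orthogonal_axis_preserving_imp_Q_form\<close>).

  With \<open>t = tan (u / 2)\<close> the circle point is \<open>(cos u, sin u)\<close>, so a rotation by \<open>\<theta>\<close> is the
  reparametrization \<open>t \<mapsto> tan ((u + \<theta>) / 2)\<close>, and the reflection \<open>x \<mapsto> - x\<close> is
  \<open>t \<mapsto> 1 / t\<close>; this yields \<open>\<phi>\<^sub>1\<close> (\<open>phi1_form_circle\<close>), which is unique because the
  stereographic parametrization is injective. The third coordinate of \<open>c\<^sub>2\<close> is
  \<open>a tan (2 arctan t)\<close>, which leaves for \<open>\<phi>\<^sub>2\<close> the two candidates \<open>\<epsilon>1 t\<close> and
  \<open>- \<epsilon>1 / t\<close>. The second one turns \<open>r\<^sub>2 = c - a W\<close> into \<open>c + a W\<close>, and these have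
  different squares (\<open>phi2_unique\<close>).

  On the geometric side, the torus lies in the ball of radius \<open>R = \<bar>a\<bar> + \<bar>c\<bar>\<close> around
  the origin and touches its boundary sphere exactly in the circle \<open>z = 0\<close>, \<open>norm p = R\<close>. The
  images of two opposite points of that circle cannot both stay in the ball unless \<open>b = 0\<close>;
  then \<open>Q\<close> maps the circle into itself, and again its third row is
  \<open>(0, 0, \<plusminus>1)\<close> (\<open>torus_symmetry_imp_axis_preserving\<close>). Conversely, the matrices
  \<open>Q_form \<epsilon>1 \<epsilon>2 \<theta>\<close> preserve the height up to sign and the distance to the axis, which are all that
  the equation of the torus involves. Both sides of the equivalence thus single out the same
  isometries.

  Finally, the rotations about the \<open>z\<close>-axis together with the reflections in planes through it
  are exactly the orthogonal maps fixing the third unit vector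
  (\<open>z_subgroup_eq_stabiliser\<close>). The flip \<open>z \<mapsto> - z\<close> commutes with all of them, and every
  symmetry is uniquely a power of the flip times such a map, which gives the product
  decomposition (\<open>iso_symmetry_group_torus\<close>).
\<close>

(* The dollar sign is reserved for the components of vectors. *)
no_notation fps_nth (infixl "$" 75)

section \<open>Real rational functions and substitution\<close>

lemma rf_const_simps:
  "rf_const 0 = 0" "rf_const 1 = 1"
  "rf_const (x + y) = rf_const x + rf_const y"
  "rf_const (x - y) = rf_const x - rf_const y"
  "rf_const (- x) = - rf_const x"
  "rf_const (x * y) = rf_const x * rf_const y"
  "rf_const (x ^ n) = rf_const x ^ n"
proof -
  show "rf_const 0 = 0" and one: "rf_const 1 = 1"
    by (simp_all add: rf_const_def flip: one_pCons)
  show "rf_const (x + y) = rf_const x + rf_const y"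
    by (simp add: rf_const_def flip: to_fract_add)
  show "rf_const (x - y) = rf_const x - rf_const y"
    by (simp add: rf_const_def flip: to_fract_diff)
  show "rf_const (- x) = - rf_const x"
    by (simp add: rf_const_def flip: to_fract_uminus)
  show m: "rf_const (x * y) = rf_const x * rf_const y" for x y
    by (simp add: rf_const_def flip: to_fract_mult)
  show "rf_const (x ^ n) = rf_const x ^ n"
    by (induction n) (simp_all add: m one)
qed

lemma rf_const_eq_iff [simp]: "rf_const x = rf_const y \<longleftrightarrow> x = y"
  by (simp add: rf_const_def)

lemma rf_const_eq_0_iff [simp]: "rf_const x = 0 \<longleftrightarrow> x = 0"
  by (simp add: rf_const_def)

text \<open>
  The variable is transcendental over the constants; degree two is all that the spine curves
  require once their denominators are cleared.
\<close>

lemma rf_quadratic_eq_0: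
  assumes "rf_const p + rf_const q * rf_var + rf_const r * rf_var\<^sup>2 = 0"
  shows "p = 0" "q = 0" "r = 0"
proof -
  have "rf_const p + rf_const q * rf_var + rf_const r * rf_var\<^sup>2 = to_fract [:p, q, r:]"
    by (simp add: rf_const_def rf_var_def power2_eq_square flip: to_fract_add to_fract_mult)
  with assms show "p = 0" "q = 0" "r = 0" by simp_all
qed

lemma rf_linear_neq_0:
  "p \<noteq> 0 \<or> q \<noteq> 0 \<Longrightarrow> rf_const p * rf_var + rf_const q \<noteq> 0"
  using rf_quadratic_eq_0[of q p 0] by (auto simp: rf_const_simps add.commute)

lemma rf_subst_pCons [simp]:
  "rf_subst (pCons x p) \<phi> = rf_const x + \<phi> * rf_subst p \<phi>"
  by (simp add: rf_subst_def map_poly_pCons rf_const_simps)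

lemma rf_subst_0 [simp]: "rf_subst 0 \<phi> = 0"
  by (simp add: rf_subst_def)

lemma rf_subst_1 [simp]: "rf_subst 1 \<phi> = 1"
  by (simp add: one_pCons rf_const_simps)

lemma rf_subst_add: "rf_subst (p + q) \<phi> = rf_subst p \<phi> + rf_subst q \<phi>"
  by (induction p q rule: poly_induct2) (simp_all add: rf_const_simps algebra_simps)

lemma rf_subst_smult: "rf_subst (smult x p) \<phi> = rf_const x * rf_subst p \<phi>"
  by (induction p) (simp_all add: rf_const_simps algebra_simps)

lemma rf_subst_mult: "rf_subst (p * q) \<phi> = rf_subst p \<phi> * rf_subst q \<phi>"
  by (induction p)
     (simp_all add: rf_const_simps rf_subst_add rf_subst_smult algebra_simps)

text \<open>
  Composition is defined through the reduced fraction. Its denominator divides every other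
  denominator \<open>q\<close> of the same function, so it cannot vanish at \<open>\<phi>\<close> when \<open>q\<close> does not,
  and the value follows by cross multiplication.
\<close>

lemma rf_comp_quotient:
  assumes "rf_subst q \<phi> \<noteq> 0"
  shows "rf_comp (to_fract p / to_fract q) \<phi> = rf_subst p \<phi> / rf_subst q \<phi>"
proof -
  have q0: "q \<noteq> 0" using assms by auto
  obtain p' q' where pq: "quot_of_fract (to_fract p / to_fract q) = (p', q')"
    by (cases "quot_of_fract (to_fract p / to_fract q)")
  have q'0: "q' \<noteq> 0" and cop: "coprime p' q'"
    using snd_quot_of_fract_nonzero[of "to_fract p / to_fract q"]
      coprime_quot_of_fract[of "to_fract p / to_fract q"] pq by auto
  have "to_fract p / to_fract q = to_fract p' / to_fract q'"
    using quot_to_fract_quot_of_fract[of "to_fract p / to_fract q"] pq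
    by (simp add: quot_to_fract_def Fract_conv_to_fract)
  then have "to_fract (p * q') = to_fract (p' * q)"
    using q0 q'0 by (simp add: field_simps)
  then have eq: "p * q' = p' * q" by (simp only: to_fract_eq_iff)
  then have "q' dvd p' * q" by (metis dvd_triv_right)
  then have "q' dvd q" using cop by (metis coprime_commute coprime_dvd_mult_right_iff)
  then obtain d where "q = q' * d" by blast
  then have "rf_subst q' \<phi> \<noteq> 0" using assms by (auto simp: rf_subst_mult)
  moreover have "rf_subst p \<phi> * rf_subst q' \<phi> = rf_subst p' \<phi> * rf_subst q \<phi>"
    using eq by (metis rf_subst_mult)
  ultimately show ?thesis
    using assms by (simp add: rf_comp_def pq field_simps)
qed

lemma rf_comp_const [simp]: "rf_comp (rf_const x) \<phi> = rf_const x"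
  using rf_comp_quotient[of 1 \<phi> "[:x:]"] by (simp add: rf_const_def rf_const_simps)

lemma rf_comp_0 [simp]: "rf_comp 0 \<phi> = 0"
  using rf_comp_const[of 0] by (simp add: rf_const_simps)

text \<open>
  Rational functions over an ordered field form a formally real field: clearing denominators leaves
  a sum of two squares of real polynomials, which would have to vanish at every point. The denominator
  of the circle parametrization is therefore never zero, even at a constant function.
\<close>

lemma rf_square_plus_1_neq_0: "1 + (\<phi>::ratfun)\<^sup>2 \<noteq> 0"
proof
  assume "1 + \<phi>\<^sup>2 = 0"
  moreover obtain u v where uv: "\<phi> = to_fract u / to_fract v" "v \<noteq> 0"
    by (metis Fract_cases Fract_conv_to_fract)
  ultimately have "to_fract (v\<^sup>2 + u\<^sup>2) = 0"
    by (simp add: field_simps power2_eq_square)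
  then have "v\<^sup>2 + u\<^sup>2 = 0" by (simp only: to_fract_eq_0_iff)
  then have "(poly v x)\<^sup>2 + (poly u x)\<^sup>2 = 0" for x
    by (metis poly_0 poly_add poly_power)
  then have "poly v x = 0" for x by (simp add: sum_power2_eq_zero_iff)
  then have "v = 0" using poly_all_0_iff_0 by blast
  with uv show False by simp
qed

lemma moebius_neq_const:
  assumes "moebius_ratfun \<phi>"
  shows "\<phi> \<noteq> rf_const k"
proof
  assume k: "\<phi> = rf_const k"
  obtain \<alpha> \<beta> \<gamma> \<delta> where det: "\<alpha> * \<delta> - \<beta> * \<gamma> \<noteq> 0"
    and \<phi>: "\<phi> = (rf_const \<alpha> * rf_var + rf_const \<beta>) / (rf_const \<gamma> * rf_var + rf_const \<delta>)"
    using assms unfolding moebius_ratfun_def by blast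
  have "rf_const \<gamma> * rf_var + rf_const \<delta> \<noteq> 0" using det by (intro rf_linear_neq_0) auto
  with k \<phi> have "rf_const (\<beta> - k * \<delta>) + rf_const (\<alpha> - k * \<gamma>) * rf_var + rf_const 0 * rf_var\<^sup>2 = 0"
    by (simp add: field_simps rf_const_simps)
  from rf_quadratic_eq_0[OF this] det show False by (simp add: algebra_simps)
qed

lemma moebius_one_minus_square_neq_0:
  assumes "moebius_ratfun \<phi>"
  shows "1 - \<phi>\<^sup>2 \<noteq> 0"
proof
  assume "1 - \<phi>\<^sup>2 = 0"
  then have "(1 - \<phi>) * (1 + \<phi>) = 0" by (simp add: algebra_simps power2_eq_square)
  then have "\<phi> = rf_const 1 \<or> \<phi> = rf_const (-1)"
    by (auto simp: rf_const_simps eq_neg_iff_add_eq_0 add.commute)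
  with moebius_neq_const[OF assms] show False by blast
qed

lemma moebius_var: "moebius_ratfun rf_var"
  unfolding moebius_ratfun_def
  by (rule exI[of _ 1], rule exI[of _ 0], rule exI[of _ 0], rule exI[of _ 1])
     (simp add: rf_const_simps)

lemma rf_one_minus_var_square_neq_0: "1 - rf_var\<^sup>2 \<noteq> 0"
  by (rule moebius_one_minus_square_neq_0[OF moebius_var])

section \<open>The spine curves and radius functions under substitution\<close>

lemma spine1_comp:
  "curve_comp (spine1 a) \<phi> =
    rf_const a *s vector [(1 - \<phi>\<^sup>2) / (1 + \<phi>\<^sup>2), 2 * \<phi> / (1 + \<phi>\<^sup>2), 0]"
proof -
  have den: "rf_subst [:1, 0, 1:] \<phi> = 1 + \<phi>\<^sup>2"
    by (simp add: rf_const_simps power2_eq_square)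
  have "rf_comp (spine1 a $ 1) \<phi> = rf_const a * ((1 - \<phi>\<^sup>2) / (1 + \<phi>\<^sup>2))"
  proof -
    have "spine1 a $ 1 = to_fract [:a, 0, -a:] / to_fract [:1, 0, 1:]"
      by (simp add: spine1_def rf_const_def rf_var_def power2_eq_square
            flip: to_fract_1 to_fract_add to_fract_diff to_fract_mult)
         (simp add: one_pCons)
    then show ?thesis
      using rf_comp_quotient[of "[:1, 0, 1:]" \<phi> "[:a, 0, -a:]"] den rf_square_plus_1_neq_0[of \<phi>]
      by (simp add: rf_const_simps power2_eq_square algebra_simps)
  qed
  moreover have "rf_comp (spine1 a $ 2) \<phi> = rf_const a * (2 * \<phi> / (1 + \<phi>\<^sup>2))"
  proof -
    have "spine1 a $ 2 = (rf_const a * rf_var + rf_const a * rf_var) / (1 + rf_var\<^sup>2)"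
      by (simp add: spine1_def)
    also have "\<dots> = to_fract [:0, 2 * a:] / to_fract [:1, 0, 1:]"
      by (simp add: rf_const_def rf_var_def power2_eq_square
            flip: to_fract_1 to_fract_add to_fract_diff to_fract_mult)
         (simp add: one_pCons)
    finally have "spine1 a $ 2 = to_fract [:0, a + a:] / to_fract [:1, 0, 1:]" by simp
    then show ?thesis
      using rf_comp_quotient[of "[:1, 0, 1:]" \<phi> "[:0, a + a:]"] den rf_square_plus_1_neq_0[of \<phi>]
      by (simp only: rf_subst_pCons rf_const_simps rf_subst_0) (simp add: algebra_simps)
  qed
  moreover have "rf_comp (spine1 a $ 3) \<phi> = 0" by (simp add: spine1_def)
  ultimately show ?thesis
    by (simp add: curve_comp_def vec_eq_iff forall_3)
qed

lemma spine2_comp: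
  assumes "moebius_ratfun \<phi>"
  shows "curve_comp (spine2 a) \<phi> = rf_const a *s vector [0, 0, 2 * \<phi> / (1 - \<phi>\<^sup>2)]"
proof -
  have den: "rf_subst [:1, 0, -1:] \<phi> = 1 - \<phi>\<^sup>2"
    by (simp add: rf_const_simps power2_eq_square)
  have "spine2 a $ 3 = (rf_const a * rf_var + rf_const a * rf_var) / (1 - rf_var\<^sup>2)"
    by (simp add: spine2_def)
  also have "\<dots> = to_fract [:0, 2 * a:] / to_fract [:1, 0, -1:]"
    by (simp add: rf_const_def rf_var_def power2_eq_square
          flip: to_fract_1 to_fract_add to_fract_diff to_fract_mult)
       (simp add: one_pCons)
  finally have "spine2 a $ 3 = to_fract [:0, a + a:] / to_fract [:1, 0, -1:]" by simp
  then have "rf_comp (spine2 a $ 3) \<phi> = rf_const a * (2 * \<phi> / (1 - \<phi>\<^sup>2))"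
    using rf_comp_quotient[of "[:1, 0, -1:]" \<phi> "[:0, a + a:]"] den
      moebius_one_minus_square_neq_0[OF assms]
    by (simp only: rf_subst_pCons rf_const_simps rf_subst_0) (simp add: algebra_simps)
  moreover have "rf_comp (spine2 a $ 1) \<phi> = 0" "rf_comp (spine2 a $ 2) \<phi> = 0"
    by (simp_all add: spine2_def)
  ultimately show ?thesis
    by (simp add: curve_comp_def vec_eq_iff forall_3)
qed

lemma radius2_comp:
  assumes "moebius_ratfun \<phi>"
  shows "rf_comp (radius2 a c) \<phi> = rf_const c - rf_const a * ((1 + \<phi>\<^sup>2) / (1 - \<phi>\<^sup>2))"
proof -
  have den: "rf_subst [:1, 0, -1:] \<phi> = 1 - \<phi>\<^sup>2"
    by (simp add: rf_const_simps power2_eq_square)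
  have "radius2 a c =
      (rf_const c * (1 - rf_var\<^sup>2) - rf_const a * (1 + rf_var\<^sup>2)) / (1 - rf_var\<^sup>2)"
    using rf_one_minus_var_square_neq_0 by (simp add: radius2_def field_simps)
  also have "\<dots> = to_fract [:c - a, 0, - c - a:] / to_fract [:1, 0, -1:]"
    by (simp add: rf_const_def rf_var_def power2_eq_square
          flip: to_fract_1 to_fract_add to_fract_diff to_fract_mult)
       (simp add: one_pCons)
  finally have "rf_comp (radius2 a c) \<phi> = rf_subst [:c - a, 0, - c - a:] \<phi> / (1 - \<phi>\<^sup>2)"
    using rf_comp_quotient[of "[:1, 0, -1:]" \<phi> "[:c - a, 0, - c - a:]"]
      moebius_one_minus_square_neq_0[OF assms]
    unfolding den by simp
  then show ?thesis
    using moebius_one_minus_square_neq_0[OF assms]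
    by (simp add: rf_const_simps power2_eq_square field_simps)
qed

text \<open>
  Stereographic projection inverts the parametrization \<open>(X, Y)\<close> of the circle:
  \<open>\<phi> = Y / (1 + X)\<close>.
\<close>

lemma circle_param_inj:
  fixes \<phi> \<psi> :: ratfun
  assumes "(1 - \<phi>\<^sup>2) / (1 + \<phi>\<^sup>2) = (1 - \<psi>\<^sup>2) / (1 + \<psi>\<^sup>2)"
    and "2 * \<phi> / (1 + \<phi>\<^sup>2) = 2 * \<psi> / (1 + \<psi>\<^sup>2)"
  shows "\<phi> = \<psi>"
proof -
  have two: "(2::ratfun) \<noteq> 0" by simp
  have recover: "\<omega> = (2 * \<omega> / (1 + \<omega>\<^sup>2)) / (1 + (1 - \<omega>\<^sup>2) / (1 + \<omega>\<^sup>2))" for \<omega> :: ratfun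
  proof -
    have "1 + (1 - \<omega>\<^sup>2) / (1 + \<omega>\<^sup>2) = 2 / (1 + \<omega>\<^sup>2)"
      using rf_square_plus_1_neq_0[of \<omega>] by (simp add: field_simps)
    then show ?thesis using rf_square_plus_1_neq_0[of \<omega>] two by simp
  qed
  show ?thesis by (metis recover assms)
qed

section \<open>Moebius transformations realising a symmetry\<close>

lemma orthogonal_matrix_rows:
  fixes Q :: "real ^ 3 ^ 3"
  assumes "orthogonal_matrix Q"
  shows "Q $ i $ 1 * Q $ j $ 1 + Q $ i $ 2 * Q $ j $ 2 + Q $ i $ 3 * Q $ j $ 3
    = (if i = j then 1 else 0)"
proof -
  have "Q ** transpose Q = mat 1" using assms by (simp add: orthogonal_matrix_def)
  then have "(Q ** transpose Q) $ i $ j = (mat 1 :: real^3^3) $ i $ j" by simp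
  then show ?thesis by (simp add: matrix_matrix_mult_def transpose_def mat_def sum_3)
qed

lemma Q_form_entries [simp]:
  "Q_form \<epsilon>1 \<epsilon>2 \<theta> $ 1 $ 1 = of_int \<epsilon>2 * cos \<theta>" "Q_form \<epsilon>1 \<epsilon>2 \<theta> $ 1 $ 2 = - of_int \<epsilon>2 * sin \<theta>"
  "Q_form \<epsilon>1 \<epsilon>2 \<theta> $ 1 $ 3 = 0" "Q_form \<epsilon>1 \<epsilon>2 \<theta> $ 2 $ 1 = sin \<theta>"
  "Q_form \<epsilon>1 \<epsilon>2 \<theta> $ 2 $ 2 = cos \<theta>" "Q_form \<epsilon>1 \<epsilon>2 \<theta> $ 2 $ 3 = 0"
  "Q_form \<epsilon>1 \<epsilon>2 \<theta> $ 3 $ 1 = 0" "Q_form \<epsilon>1 \<epsilon>2 \<theta> $ 3 $ 2 = 0"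
  "Q_form \<epsilon>1 \<epsilon>2 \<theta> $ 3 $ 3 = of_int \<epsilon>1"
  by (simp_all add: Q_form_def)

lemma orthogonal_Q_form:
  assumes "\<epsilon>1 \<in> {-1, 1}" "\<epsilon>2 \<in> {-1, 1}"
  shows "orthogonal_matrix (Q_form \<epsilon>1 \<epsilon>2 \<theta>)"
  unfolding orthogonal_matrix
  using assms sin_cos_squared_add3[of \<theta>]
  by (auto simp: vec_eq_iff forall_3 matrix_matrix_mult_def transpose_def mat_def sum_3
      algebra_simps)

text \<open>
  Orthogonality of the rows propagates the zeros of the third row to the third column, which leaves
  an orthogonal matrix of size two: its second row is a unit vector and yields \<open>\<theta>\<close>, its first row
  is one of the two unit vectors orthogonal to the second.
\<close>

lemma orthogonal_axis_preserving_imp_Q_form: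
  fixes Q :: "real ^ 3 ^ 3"
  assumes orth: "orthogonal_matrix Q" and z: "Q $ 3 $ 1 = 0" "Q $ 3 $ 2 = 0"
  shows "\<exists>\<epsilon>1\<in>{-1, 1}. \<exists>\<epsilon>2\<in>{-1, 1}. \<exists>\<theta>\<in>{0..<2 * pi}. Q = Q_form \<epsilon>1 \<epsilon>2 \<theta>"
proof -
  note row = orthogonal_matrix_rows[OF orth]
  have z33: "(Q $ 3 $ 3)\<^sup>2 = 1" using row[of 3 3] z by (simp add: power2_eq_square)
  then have z13: "Q $ 1 $ 3 = 0" "Q $ 2 $ 3 = 0" using row[of 1 3] row[of 2 3] z by auto
  have "(Q $ 2 $ 2)\<^sup>2 + (Q $ 2 $ 1)\<^sup>2 = 1" using row[of 2 2] z13 by (simp add: power2_eq_square)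
  then obtain \<theta> where \<theta>: "0 \<le> \<theta>" "\<theta> < 2 * pi" "Q $ 2 $ 2 = cos \<theta>" "Q $ 2 $ 1 = sin \<theta>"
    using sincos_total_2pi by metis
  \<comment> \<open>The first row is orthogonal to the unit vector \<open>(sin \<theta>, cos \<theta>)\<close>, hence a multiple of
    \<open>(cos \<theta>, - sin \<theta>)\<close>; \<open>e\<close> is the factor.\<close>
  define e where "e = Q $ 1 $ 1 * cos \<theta> - Q $ 1 $ 2 * sin \<theta>"
  have perp: "Q $ 1 $ 1 * sin \<theta> + Q $ 1 $ 2 * cos \<theta> = 0" using row[of 1 2] z13 \<theta> by simp
  have sc: "cos \<theta> * cos \<theta> + sin \<theta> * sin \<theta> = 1" by simp
  have e1: "Q $ 1 $ 1 = e * cos \<theta>" unfolding e_def using perp sc by algebra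
  have e2: "Q $ 1 $ 2 = - e * sin \<theta>" unfolding e_def using perp sc by algebra
  have "Q $ 1 $ 1 * Q $ 1 $ 1 + Q $ 1 $ 2 * Q $ 1 $ 2 = 1" using row[of 1 1] z13 by simp
  then have "e\<^sup>2 = 1" unfolding e1 e2 using sc by algebra
  then obtain \<epsilon>2 :: int where "\<epsilon>2 \<in> {-1, 1}" "e = of_int \<epsilon>2"
    by (metis insertI1 insertI2 of_int_1 of_int_minus power2_eq_1_iff)
  moreover obtain \<epsilon>1 :: int where "\<epsilon>1 \<in> {-1, 1}" "Q $ 3 $ 3 = of_int \<epsilon>1"
    using z33 by (metis insertI1 insertI2 of_int_1 of_int_minus power2_eq_1_iff)
  ultimately have "Q = Q_form \<epsilon>1 \<epsilon>2 \<theta>"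
    using z z13 \<theta> e1 e2 by (simp add: vec_eq_iff forall_3)
  with \<open>\<epsilon>1 \<in> {-1, 1}\<close> \<open>\<epsilon>2 \<in> {-1, 1}\<close> \<theta> show ?thesis by (metis atLeastLessThan_iff)
qed

lemma affine_curve_nth:
  "affine_curve Q b u $ i =
    rf_const (Q $ i $ 1) * u $ 1 + rf_const (Q $ i $ 2) * u $ 2 + rf_const (Q $ i $ 3) * u $ 3
      + rf_const (b $ i)"
  by (simp add: affine_curve_def matrix_vector_mult_def map_matrix_def sum_3)

text \<open>
  The first spine curve spans the plane \<open>z = 0\<close>, so a vanishing third coordinate of its image
  kills the matching part of the third row and \<open>b $ 3\<close>. The second spine curve is odd, so the
  constant terms in the remaining coordinates of its image are those of \<open>b\<close>.
\<close>

lemma condA1_imp_axis_preserving: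
  assumes a: "a \<noteq> 0" and m: "moebius_ratfun \<phi>2" and A1: "condA1 a Q b \<phi>1 \<phi>2"
  shows "Q $ 3 $ 1 = 0" "Q $ 3 $ 2 = 0" "b = 0"
proof -
  let ?t = rf_var
  let ?X = "(1 - ?t\<^sup>2) / (1 + ?t\<^sup>2)" and ?Y = "2 * ?t / (1 + ?t\<^sup>2)" and ?Z = "2 * ?t / (1 - ?t\<^sup>2)"
  have s1: "affine_curve Q b (spine1 a) = curve_comp (spine1 a) \<phi>1"
    and s2: "affine_curve Q b (spine2 a) = curve_comp (spine2 a) \<phi>2"
    using A1 by (auto simp: condA1_def)
  have "affine_curve Q b (spine1 a) $ 3 = 0" unfolding s1 by (simp add: spine1_comp)
  then have "rf_const (Q $ 3 $ 1) * (rf_const a * ?X) + rf_const (Q $ 3 $ 2) * (rf_const a * ?Y)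
      + rf_const (b $ 3) = 0"
    by (simp add: affine_curve_nth spine1_def)
  moreover have "?X * (1 + ?t\<^sup>2) = 1 - ?t\<^sup>2" "?Y * (1 + ?t\<^sup>2) = 2 * ?t"
    using rf_square_plus_1_neq_0[of ?t] by simp_all
  ultimately have lin: "rf_const (Q $ 3 $ 1 * a + b $ 3) + rf_const (Q $ 3 $ 2 * a + Q $ 3 $ 2 * a) * ?t
      + rf_const (b $ 3 - Q $ 3 $ 1 * a) * ?t\<^sup>2 = 0"
    unfolding rf_const_simps by algebra
  from rf_quadratic_eq_0[OF lin] a
  show "Q $ 3 $ 1 = 0" "Q $ 3 $ 2 = 0" by auto
  with rf_quadratic_eq_0(1)[OF lin] have b3: "b $ 3 = 0" by simp
  have b12: "b $ i = 0" if "i = 1 \<or> i = 2" for i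
  proof -
    have "affine_curve Q b (spine2 a) $ i = 0"
      unfolding s2 using that by (auto simp: spine2_comp[OF m])
    then have "rf_const (Q $ i $ 3) * (rf_const a * ?Z) + rf_const (b $ i) = 0"
      by (simp add: affine_curve_nth spine2_def)
    moreover have "?Z * (1 - ?t\<^sup>2) = 2 * ?t" using rf_one_minus_var_square_neq_0 by simp
    ultimately have "rf_const (b $ i) + rf_const (Q $ i $ 3 * a + Q $ i $ 3 * a) * ?t
      + rf_const (- (b $ i)) * ?t\<^sup>2 = 0"
      unfolding rf_const_simps by algebra
    from rf_quadratic_eq_0[OF this] show ?thesis by simp
  qed
  show "b = 0" using b3 b12 by (simp add: vec_eq_iff forall_3)
qed

lemma sin_cos_half:
  "rf_const (cos (\<theta> / 2)) * rf_const (cos (\<theta> / 2)) + rf_const (sin (\<theta> / 2)) * rf_const (sin (\<theta> / 2)) = 1"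
  "rf_const (cos \<theta>) = rf_const (cos (\<theta> / 2)) * rf_const (cos (\<theta> / 2)) - rf_const (sin (\<theta> / 2)) * rf_const (sin (\<theta> / 2))"
  "rf_const (sin \<theta>) = 2 * (rf_const (sin (\<theta> / 2)) * rf_const (cos (\<theta> / 2)))"
proof -
  show "rf_const (cos (\<theta> / 2)) * rf_const (cos (\<theta> / 2)) + rf_const (sin (\<theta> / 2)) * rf_const (sin (\<theta> / 2)) = 1"
    by (simp flip: rf_const_simps)
  show "rf_const (cos \<theta>) = rf_const (cos (\<theta> / 2)) * rf_const (cos (\<theta> / 2)) - rf_const (sin (\<theta> / 2)) * rf_const (sin (\<theta> / 2))"
    using cos_double[of "\<theta> / 2"] by (simp add: power2_eq_square flip: rf_const_simps)
  have "sin \<theta> = sin (\<theta> / 2) * cos (\<theta> / 2) + sin (\<theta> / 2) * cos (\<theta> / 2)"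
    using sin_double[of "\<theta> / 2"] by simp
  then have "rf_const (sin \<theta>) = rf_const (sin (\<theta> / 2)) * rf_const (cos (\<theta> / 2))
      + rf_const (sin (\<theta> / 2)) * rf_const (cos (\<theta> / 2))"
    by (metis rf_const_simps(3,6))
  then show "rf_const (sin \<theta>) = 2 * (rf_const (sin (\<theta> / 2)) * rf_const (cos (\<theta> / 2)))"
    by simp
qed

text \<open>
  For \<open>t = tan (u / 2)\<close>, the quotient \<open>N / D\<close> is the addition formula for
  \<open>tan ((u + \<theta>) / 2)\<close>.
\<close>

lemma phi1_form_cases:
  fixes \<theta> :: real
  defines "N \<equiv> rf_const (cos (\<theta> / 2)) * rf_var + rf_const (sin (\<theta> / 2))"
    and "D \<equiv> rf_const (- sin (\<theta> / 2)) * rf_var + rf_const (cos (\<theta> / 2))"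
  shows "phi1_form 1 \<theta> = N / D" "phi1_form (-1) \<theta> = D / N" "N \<noteq> 0" "D \<noteq> 0"
proof -
  have sc: "cos (\<theta> / 2) \<noteq> 0 \<or> sin (\<theta> / 2) \<noteq> 0" by (metis sin_zero_abs_cos_one abs_zero zero_neq_one)
  then show "N \<noteq> 0" "D \<noteq> 0" unfolding N_def D_def by (auto intro!: rf_linear_neq_0)
  have "rf_const (sin (\<theta> / 2)) * rf_var - rf_const (cos (\<theta> / 2)) = - D"
    by (simp add: D_def rf_const_simps)
  then have "phi1_form e \<theta> = - ((N / - D) powi e)" for e
    by (simp only: phi1_form_def N_def)
  then show "phi1_form 1 \<theta> = N / D" "phi1_form (-1) \<theta> = D / N"
    by (simp_all add: power_int_minus)
qed

lemma moebius_phi1_form: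
  assumes "\<epsilon>2 \<in> {-1, 1}"
  shows "moebius_ratfun (phi1_form \<epsilon>2 \<theta>)"
proof -
  let ?C = "cos (\<theta> / 2)" and ?S = "sin (\<theta> / 2)"
  have one: "?C * ?C + ?S * ?S = 1" by simp
  have "moebius_ratfun (phi1_form 1 \<theta>)"
    unfolding moebius_ratfun_def phi1_form_cases
    by (rule exI[of _ ?C], rule exI[of _ ?S], rule exI[of _ "- ?S"], rule exI[of _ ?C])
       (use one in simp)
  moreover have "moebius_ratfun (phi1_form (-1) \<theta>)"
    unfolding moebius_ratfun_def phi1_form_cases
    by (rule exI[of _ "- ?S"], rule exI[of _ ?C], rule exI[of _ ?C], rule exI[of _ ?S])
       (use one in \<open>auto simp del: sin_cos_squared_add3\<close>)
  ultimately show ?thesis using assms by auto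
qed

text \<open>
  In homogeneous coordinates both orders of the quotient share the denominator
  \<open>D\<^sup>2 + N\<^sup>2\<close>; exchanging \<open>N\<close> and \<open>D\<close> only changes the sign of the first coordinate,
  which is the role of the exponent \<open>\<epsilon>2\<close>.
\<close>

lemma circle_param_quotient:
  fixes N D :: ratfun
  assumes "D \<noteq> 0"
  shows "(1 - (N / D)\<^sup>2) / (1 + (N / D)\<^sup>2) = (D\<^sup>2 - N\<^sup>2) / (D\<^sup>2 + N\<^sup>2)"
    and "2 * (N / D) / (1 + (N / D)\<^sup>2) = 2 * N * D / (D\<^sup>2 + N\<^sup>2)"
proof -
  have *: "1 + (N / D)\<^sup>2 = (D\<^sup>2 + N\<^sup>2) / D\<^sup>2" "1 - (N / D)\<^sup>2 = (D\<^sup>2 - N\<^sup>2) / D\<^sup>2"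
    using assms by (simp_all add: field_simps)
  show "(1 - (N / D)\<^sup>2) / (1 + (N / D)\<^sup>2) = (D\<^sup>2 - N\<^sup>2) / (D\<^sup>2 + N\<^sup>2)"
    unfolding * using assms by simp
  show "2 * (N / D) / (1 + (N / D)\<^sup>2) = 2 * N * D / (D\<^sup>2 + N\<^sup>2)"
    unfolding * using assms by (simp add: power2_eq_square)
qed

text \<open>
  These are the double-angle formulas for \<open>N / D = tan ((u + \<theta>) / 2)\<close>, written as polynomial
  identities: \<open>D\<^sup>2 + N\<^sup>2 = 1 + t\<^sup>2\<close>, while \<open>D\<^sup>2 - N\<^sup>2\<close> and \<open>2 N D\<close> are the two coordinates
  of the rotated circle times \<open>1 + t\<^sup>2\<close>.
\<close>

lemma phi1_form_circle:
  fixes \<epsilon>2 :: int and \<theta> :: real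
  assumes "\<epsilon>2 \<in> {-1, 1}"
  defines "\<phi> \<equiv> phi1_form \<epsilon>2 \<theta>" and "X \<equiv> (1 - rf_var\<^sup>2) / (1 + rf_var\<^sup>2)"
    and "Y \<equiv> 2 * rf_var / (1 + rf_var\<^sup>2)"
  shows "(1 - \<phi>\<^sup>2) / (1 + \<phi>\<^sup>2)
      = rf_const (of_int \<epsilon>2 * cos \<theta>) * X + rf_const (- of_int \<epsilon>2 * sin \<theta>) * Y"
    and "2 * \<phi> / (1 + \<phi>\<^sup>2) = rf_const (sin \<theta>) * X + rf_const (cos \<theta>) * Y"
proof -
  define N where "N = rf_const (cos (\<theta> / 2)) * rf_var + rf_const (sin (\<theta> / 2))"
  define D where "D = rf_const (- sin (\<theta> / 2)) * rf_var + rf_const (cos (\<theta> / 2))"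
  note cases = phi1_form_cases[of \<theta>, folded N_def D_def]
  have sum: "D\<^sup>2 + N\<^sup>2 = 1 + rf_var\<^sup>2" "N\<^sup>2 + D\<^sup>2 = 1 + rf_var\<^sup>2"
    unfolding N_def D_def rf_const_simps using sin_cos_half(1)[of \<theta>] by algebra+
  have diff: "D\<^sup>2 - N\<^sup>2 = rf_const (cos \<theta>) * (1 - rf_var\<^sup>2) - rf_const (sin \<theta>) * (2 * rf_var)"
    unfolding N_def D_def rf_const_simps sin_cos_half(2,3)[of \<theta>] by algebra
  have prod: "2 * N * D = rf_const (sin \<theta>) * (1 - rf_var\<^sup>2) + rf_const (cos \<theta>) * (2 * rf_var)"
    unfolding N_def D_def rf_const_simps sin_cos_half(2,3)[of \<theta>] by algebra
  have X: "rf_const (cos \<theta>) * X - rf_const (sin \<theta>) * Y = (D\<^sup>2 - N\<^sup>2) / (1 + rf_var\<^sup>2)"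
    unfolding diff X_def Y_def by (simp only: times_divide_eq_right diff_divide_distrib[symmetric])
  have Y: "rf_const (sin \<theta>) * X + rf_const (cos \<theta>) * Y = 2 * N * D / (1 + rf_var\<^sup>2)"
    unfolding prod X_def Y_def by (simp add: add_divide_distrib)
  have neg: "(N\<^sup>2 - D\<^sup>2) / (1 + rf_var\<^sup>2) = - ((D\<^sup>2 - N\<^sup>2) / (1 + rf_var\<^sup>2))"
    by (metis minus_diff_eq minus_divide_left)
  have com: "2 * D * N = 2 * N * D" by simp
  from assms(1) consider "\<epsilon>2 = 1" | "\<epsilon>2 = -1" by blast
  then show "(1 - \<phi>\<^sup>2) / (1 + \<phi>\<^sup>2)
      = rf_const (of_int \<epsilon>2 * cos \<theta>) * X + rf_const (- of_int \<epsilon>2 * sin \<theta>) * Y"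
    unfolding \<phi>_def
  proof cases
    case 1
    then show "(1 - (phi1_form \<epsilon>2 \<theta>)\<^sup>2) / (1 + (phi1_form \<epsilon>2 \<theta>)\<^sup>2)
      = rf_const (of_int \<epsilon>2 * cos \<theta>) * X + rf_const (- of_int \<epsilon>2 * sin \<theta>) * Y"
      by (simp add: cases(1) circle_param_quotient[OF cases(4)] sum rf_const_simps flip: X)
  next
    case 2
    then show "(1 - (phi1_form \<epsilon>2 \<theta>)\<^sup>2) / (1 + (phi1_form \<epsilon>2 \<theta>)\<^sup>2)
      = rf_const (of_int \<epsilon>2 * cos \<theta>) * X + rf_const (- of_int \<epsilon>2 * sin \<theta>) * Y"
      by (simp add: cases(2) circle_param_quotient[OF cases(3)] sum neg rf_const_simps flip: X)
  qed
  from assms(1) show "2 * \<phi> / (1 + \<phi>\<^sup>2) = rf_const (sin \<theta>) * X + rf_const (cos \<theta>) * Y"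
    unfolding \<phi>_def Y
    by (auto simp only: cases(1,2) circle_param_quotient[OF cases(3)]
        circle_param_quotient[OF cases(4)] sum com)
qed

lemma spine1_phi1_form:
  assumes "\<epsilon>2 \<in> {-1, 1}"
  shows "affine_curve (Q_form \<epsilon>1 \<epsilon>2 \<theta>) 0 (spine1 a)
    = curve_comp (spine1 a) (phi1_form \<epsilon>2 \<theta>)"
proof -
  let ?X = "(1 - rf_var\<^sup>2) / (1 + rf_var\<^sup>2)" and ?Y = "2 * rf_var / (1 + rf_var\<^sup>2)"
  have "affine_curve (Q_form \<epsilon>1 \<epsilon>2 \<theta>) 0 (spine1 a) = rf_const a *s vector
     [rf_const (of_int \<epsilon>2 * cos \<theta>) * ?X + rf_const (- of_int \<epsilon>2 * sin \<theta>) * ?Y,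
      rf_const (sin \<theta>) * ?X + rf_const (cos \<theta>) * ?Y, 0]"
    by (simp add: vec_eq_iff forall_3 affine_curve_nth spine1_def rf_const_simps(1))
       (simp add: algebra_simps)
  also have "\<dots> = curve_comp (spine1 a) (phi1_form \<epsilon>2 \<theta>)"
    by (simp only: spine1_comp phi1_form_circle[OF assms])
  finally show ?thesis .
qed

lemma moebius_phi2_form:
  assumes "\<epsilon>1 \<in> {-1, 1}"
  shows "moebius_ratfun (phi2_form \<epsilon>1)"
proof -
  have "of_int \<epsilon>1 = rf_const (of_int \<epsilon>1)" using assms by (auto simp: rf_const_simps)
  then show ?thesis unfolding moebius_ratfun_def phi2_form_def
    by (intro exI[of _ "of_int \<epsilon>1"] exI[of _ 0] exI[of _ 1])
       (use assms in \<open>auto simp: rf_const_simps\<close>)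
qed

lemma phi2_form_square: "\<epsilon>1 \<in> {-1, 1} \<Longrightarrow> (phi2_form \<epsilon>1)\<^sup>2 = rf_var\<^sup>2"
  by (auto simp: phi2_form_def)

lemma spine2_phi2_form:
  assumes "\<epsilon>1 \<in> {-1, 1}"
  shows "affine_curve (Q_form \<epsilon>1 \<epsilon>2 \<theta>) 0 (spine2 a) = curve_comp (spine2 a) (phi2_form \<epsilon>1)"
  unfolding spine2_comp[OF moebius_phi2_form[OF assms]] phi2_form_square[OF assms]
  using assms by (auto simp: vec_eq_iff forall_3 affine_curve_nth spine2_def phi2_form_def
      rf_const_simps)

lemma phi1_unique:
  assumes "a \<noteq> 0" "curve_comp (spine1 a) \<phi> = curve_comp (spine1 a) \<psi>"
  shows "\<phi> = \<psi>"
proof -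
  have "curve_comp (spine1 a) \<phi> $ i = curve_comp (spine1 a) \<psi> $ i" for i
    using assms by simp
  from this[of 1] this[of 2]
  have "rf_const a * ((1 - \<phi>\<^sup>2) / (1 + \<phi>\<^sup>2)) = rf_const a * ((1 - \<psi>\<^sup>2) / (1 + \<psi>\<^sup>2))"
    and "rf_const a * (2 * \<phi> / (1 + \<phi>\<^sup>2)) = rf_const a * (2 * \<psi> / (1 + \<psi>\<^sup>2))"
    by (simp_all only: spine1_comp vector_smult_component vector_3)
  moreover have "rf_const a \<noteq> 0" using assms(1) by simp
  ultimately show ?thesis
    using circle_param_inj[of \<phi> \<psi>] mult_left_cancel by blast
qed

text \<open>
  Equality of \<open>\<phi> / (1 - \<phi>\<^sup>2)\<close> and \<open>\<psi> / (1 - \<psi>\<^sup>2)\<close> factors as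
  \<open>(\<phi> - \<psi>) (1 + \<phi> \<psi>) = 0\<close>. In the second case \<open>(1 + \<phi>\<^sup>2) / (1 - \<phi>\<^sup>2)\<close> is minus the
  corresponding function of the variable, and the squared radii differ by \<open>4 a c\<close> times that
  function.
\<close>

lemma phi2_unique:
  assumes a: "a \<noteq> 0" and c: "c \<noteq> 0" and e: "\<epsilon>1 \<in> {-1, 1}" and m: "moebius_ratfun \<phi>"
    and s: "curve_comp (spine2 a) \<phi> = curve_comp (spine2 a) (phi2_form \<epsilon>1)"
    and r: "(radius2 a c)\<^sup>2 = (rf_comp (radius2 a c) \<phi>)\<^sup>2"
  shows "\<phi> = phi2_form \<epsilon>1"
proof -
  define \<psi> where "\<psi> = phi2_form \<epsilon>1"
  define W where "W = (1 + rf_var\<^sup>2) / (1 - rf_var\<^sup>2)"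
  have m': "moebius_ratfun \<psi>" unfolding \<psi>_def by (rule moebius_phi2_form[OF e])
  have \<psi>2: "\<psi>\<^sup>2 = rf_var\<^sup>2" unfolding \<psi>_def by (rule phi2_form_square[OF e])
  note n\<phi> = moebius_one_minus_square_neq_0[OF m] and n\<psi> = moebius_one_minus_square_neq_0[OF m']
  have "curve_comp (spine2 a) \<phi> $ 3 = curve_comp (spine2 a) \<psi> $ 3" using s \<psi>_def by simp
  then have "rf_const a * (2 * \<phi> / (1 - \<phi>\<^sup>2)) = rf_const a * (2 * \<psi> / (1 - \<psi>\<^sup>2))"
    unfolding spine2_comp[OF m] spine2_comp[OF m'] by simp
  then have "2 * \<phi> / (1 - \<phi>\<^sup>2) = 2 * \<psi> / (1 - \<psi>\<^sup>2)"
    using a by (metis mult_left_cancel rf_const_eq_0_iff)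
  then have "2 * \<phi> * (1 - \<psi>\<^sup>2) = 2 * \<psi> * (1 - \<phi>\<^sup>2)"
    by (rule iffD1[OF frac_eq_eq[OF n\<phi> n\<psi>]])
  then have "\<phi> * (1 - \<psi>\<^sup>2) = \<psi> * (1 - \<phi>\<^sup>2)" by simp
  then have "(\<phi> - \<psi>) * (1 + \<phi> * \<psi>) = 0" by algebra
  moreover have "1 + \<phi> * \<psi> \<noteq> 0"
  proof
    assume "1 + \<phi> * \<psi> = 0"
    then have "(1 + \<phi>\<^sup>2) * (1 - \<psi>\<^sup>2) = - ((1 + \<psi>\<^sup>2) * (1 - \<phi>\<^sup>2))" by algebra
    then have "(1 + \<phi>\<^sup>2) / (1 - \<phi>\<^sup>2) = - ((1 + \<psi>\<^sup>2) / (1 - \<psi>\<^sup>2))"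
      using n\<phi> n\<psi> by (simp add: field_simps)
    then have "(1 + \<phi>\<^sup>2) / (1 - \<phi>\<^sup>2) = - W" by (simp add: W_def \<psi>2)
    then have "(rf_const c - rf_const a * W)\<^sup>2 = (rf_const c + rf_const a * W)\<^sup>2"
      using r unfolding radius2_comp[OF m] by (simp add: radius2_def flip: W_def)
    then have "4 * (rf_const a * rf_const c * W) = 0" by algebra
    then show False
      using a c rf_square_plus_1_neq_0[of rf_var] rf_one_minus_var_square_neq_0
      by (simp add: W_def)
  qed
  ultimately show ?thesis by (simp add: \<psi>_def)
qed

theorem moebius_conditions_iff:
  assumes a: "a \<noteq> 0" and c: "c \<noteq> 0" and orth: "orthogonal_matrix Q"
  shows "moebius_ratfun \<phi>1 \<and> moebius_ratfun \<phi>2 \<and> condA1 a Q b \<phi>1 \<phi>2 \<and> condA2 a c \<phi>1 \<phi>2 \<longleftrightarrow>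
    (\<exists>\<epsilon>1\<in>{-1, 1}. \<exists>\<epsilon>2\<in>{-1, 1}. \<exists>\<theta>\<in>{0..<2 * pi}.
       \<phi>1 = phi1_form \<epsilon>2 \<theta> \<and> \<phi>2 = phi2_form \<epsilon>1 \<and> Q = Q_form \<epsilon>1 \<epsilon>2 \<theta> \<and> b = 0)" (is "?L \<longleftrightarrow> ?R")
proof
  assume L: ?L
  then have axis: "Q $ 3 $ 1 = 0" "Q $ 3 $ 2 = 0" and b: "b = 0"
    using condA1_imp_axis_preserving[OF a] by blast+
  then obtain \<epsilon>1 \<epsilon>2 \<theta> where e: "\<epsilon>1 \<in> {-1, 1}" "\<epsilon>2 \<in> {-1, 1}" "\<theta> \<in> {0..<2 * pi}"
    and Q: "Q = Q_form \<epsilon>1 \<epsilon>2 \<theta>"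
    using orthogonal_axis_preserving_imp_Q_form[OF orth] by blast
  have "curve_comp (spine1 a) \<phi>1 = curve_comp (spine1 a) (phi1_form \<epsilon>2 \<theta>)"
    using L spine1_phi1_form[OF e(2)] by (simp add: condA1_def Q b)
  then have "\<phi>1 = phi1_form \<epsilon>2 \<theta>" by (rule phi1_unique[OF a])
  moreover have "curve_comp (spine2 a) \<phi>2 = curve_comp (spine2 a) (phi2_form \<epsilon>1)"
    using L spine2_phi2_form[OF e(1)] by (simp add: condA1_def Q b)
  then have "\<phi>2 = phi2_form \<epsilon>1"
    using L by (intro phi2_unique[OF a c e(1)]) (auto simp: condA2_def)
  ultimately show ?R using e Q b by blast
next
  assume ?R
  then obtain \<epsilon>1 \<epsilon>2 \<theta> where e: "\<epsilon>1 \<in> {-1, 1}" "\<epsilon>2 \<in> {-1, 1}"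
    and eqs: "\<phi>1 = phi1_form \<epsilon>2 \<theta>" "\<phi>2 = phi2_form \<epsilon>1" "Q = Q_form \<epsilon>1 \<epsilon>2 \<theta>" "b = 0"
    by blast
  have "condA2 a c \<phi>1 \<phi>2"
    unfolding condA2_def eqs radius2_comp[OF moebius_phi2_form[OF e(1)]] phi2_form_square[OF e(1)]
    by (simp add: radius1_def radius2_def)
  then show ?L
    unfolding eqs condA1_def
    using moebius_phi1_form[OF e(2)] moebius_phi2_form[OF e(1)] spine1_phi1_form[OF e(2)]
      spine2_phi2_form[OF e(1)]
    by simp
qed

section \<open>Isometries preserving the torus\<close>

lemma norm_vec3: "(norm (p :: real ^ 3))\<^sup>2 = (p $ 1)\<^sup>2 + (p $ 2)\<^sup>2 + (p $ 3)\<^sup>2"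
  unfolding power2_norm_eq_inner by (simp add: inner_vec_def sum_3 power2_eq_square)

text \<open>
  The distance to the axis is at most the norm, so the quartic equation bounds
  \<open>(norm p - \<bar>a\<bar>)\<^sup>2\<close> by \<open>c\<^sup>2\<close>. The argument does not distinguish ring, horn and spindle
  tori.
\<close>

lemma torus_norm_le:
  assumes "p \<in> torus_cyclide a c"
  shows "norm p \<le> \<bar>a\<bar> + \<bar>c\<bar>"
proof -
  have "((norm p)\<^sup>2 + a\<^sup>2 - c\<^sup>2)\<^sup>2 = 4 * a\<^sup>2 * ((p $ 1)\<^sup>2 + (p $ 2)\<^sup>2)"
    using assms by (simp add: torus_cyclide_def norm_vec3)
  also have "\<dots> \<le> 4 * a\<^sup>2 * (norm p)\<^sup>2" by (intro mult_left_mono) (simp_all add: norm_vec3)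
  also have "\<dots> = (2 * \<bar>a\<bar> * norm p)\<^sup>2" by (simp add: power_mult_distrib)
  finally have "(norm p)\<^sup>2 + a\<^sup>2 - c\<^sup>2 \<le> 2 * \<bar>a\<bar> * norm p"
    by (rule power2_le_imp_le) simp
  then have "(norm p - \<bar>a\<bar>)\<^sup>2 \<le> \<bar>c\<bar>\<^sup>2" by (simp add: power2_diff algebra_simps)
  then have "norm p - \<bar>a\<bar> \<le> \<bar>c\<bar>" by (rule power2_le_imp_le) simp
  then show ?thesis by simp
qed

text \<open>
  At this norm the quartic's first square equals \<open>(2 \<bar>a\<bar> norm p)\<^sup>2\<close>, so the equation
  says that the distance to the axis is the full norm.
\<close>

lemma torus_extremal_circle:
  assumes a: "a \<noteq> 0" and n: "norm p = \<bar>a\<bar> + \<bar>c\<bar>"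
  shows "p \<in> torus_cyclide a c \<longleftrightarrow> p $ 3 = 0"
proof -
  have "p \<in> torus_cyclide a c \<longleftrightarrow>
    ((norm p)\<^sup>2 + a\<^sup>2 - c\<^sup>2)\<^sup>2 = 4 * a\<^sup>2 * ((norm p)\<^sup>2 - (p $ 3)\<^sup>2)"
    by (simp add: torus_cyclide_def norm_vec3)
  also have "(norm p)\<^sup>2 + a\<^sup>2 - c\<^sup>2 = 2 * \<bar>a\<bar> * norm p"
    unfolding n by (simp add: power2_sum power2_eq_square algebra_simps)
  also have "(2 * \<bar>a\<bar> * norm p)\<^sup>2 = 4 * a\<^sup>2 * (norm p)\<^sup>2" by (simp add: power_mult_distrib)
  finally show ?thesis using a by simp
qed

text \<open>
  By the parallelogram law, the images \<open>b + Q p\<close> and \<open>b - Q p\<close> of two opposite points on the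
  extremal circle have squared norms adding up to \<open>2 R\<^sup>2 + 2 (norm b)\<^sup>2\<close>, which leaves room only for
  \<open>b = 0\<close>. Then \<open>Q\<close> maps extremal points to extremal points, and the multiples of the first two unit
  vectors on the circle show that the corresponding entries of the third row vanish.
\<close>

lemma torus_symmetry_imp_axis_preserving:
  assumes a: "a \<noteq> 0" and orth: "orthogonal_matrix Q"
    and inv: "affine_map Q b ` torus_cyclide a c = torus_cyclide a c"
  shows "b = 0" "Q $ 3 $ 1 = 0" "Q $ 3 $ 2 = 0"
proof -
  define R where "R = \<bar>a\<bar> + \<bar>c\<bar>"
  have R: "R > 0" using a by (simp add: R_def)
  have "orthogonal_transformation ((*v) Q)"
    using orth by (simp add: orthogonal_transformation_matrix)
  then have isom: "norm (Q *v x) = norm x" for x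
    by (rule orthogonal_transformation_norm)
  have mem: "p \<in> torus_cyclide a c" if "p $ 3 = 0" "norm p = R" for p
    using that torus_extremal_circle[OF a, of p c] by (simp add: R_def)
  have img: "Q *v p + b \<in> torus_cyclide a c" if "p \<in> torus_cyclide a c" for p
    using that inv by (auto simp: affine_map_def)
  have norm_axis: "norm (axis k R :: real^3) = R" for k
  proof -
    have "(norm (axis k R :: real^3))\<^sup>2 = R\<^sup>2"
      using exhaust_3[of k] by (auto simp: norm_vec3 axis_def)
    then show ?thesis using R by simp
  qed
  define p :: "real^3" where "p = axis 1 R"
  have p: "norm p = R" "p $ 3 = 0" by (simp_all add: p_def norm_axis, simp add: axis_def)
  have "norm (Q *v p + b) \<le> R" "norm (Q *v (- p) + b) \<le> R"
    using p unfolding R_def by (intro torus_norm_le img mem; simp add: R_def)+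
  then have "(norm (Q *v p + b))\<^sup>2 \<le> R\<^sup>2" "(norm (b - Q *v p))\<^sup>2 \<le> R\<^sup>2"
    using matrix_vector_mult_diff_distrib[of Q 0 p] by (simp_all add: power_mono)
  moreover have "(norm (Q *v p + b))\<^sup>2 + (norm (b - Q *v p))\<^sup>2 = 2 * R\<^sup>2 + 2 * (norm b)\<^sup>2"
  proof -
    have "(norm (Q *v p + b))\<^sup>2 + (norm (b - Q *v p))\<^sup>2 = 2 * (norm (Q *v p))\<^sup>2 + 2 * (norm b)\<^sup>2"
      unfolding power2_norm_eq_inner
      by (simp add: inner_add_left inner_add_right inner_diff_left inner_diff_right inner_commute)
    then show ?thesis by (simp only: isom p(1))
  qed
  ultimately have "(norm b)\<^sup>2 \<le> 0" by linarith
  then show b: "b = 0" by simp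
  have z: "(Q *v q) $ 3 = 0" if "norm q = R" "q $ 3 = 0" for q
    using img[OF mem[OF that(2,1)]] torus_extremal_circle[OF a, of "Q *v q" c] that isom[of q] b
    by (simp add: R_def)
  have "(Q *v axis 1 R) $ 3 = 0" "(Q *v axis 2 R) $ 3 = 0"
    by (rule z, rule norm_axis, simp add: axis_def)+
  then show "Q $ 3 $ 1 = 0" "Q $ 3 $ 2 = 0"
    using R by (simp_all add: matrix_vector_mult_def sum_3 axis_def)
qed

lemma Q_form_preserves_torus:
  assumes e: "\<epsilon>1 \<in> {-1, 1}" "\<epsilon>2 \<in> {-1, 1}"
  shows "affine_map (Q_form \<epsilon>1 \<epsilon>2 \<theta>) 0 ` torus_cyclide a c = torus_cyclide a c"
proof -
  let ?Q = "Q_form \<epsilon>1 \<epsilon>2 \<theta>"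
  have sq: "of_int \<epsilon>1 * of_int \<epsilon>1 = (1::real)" "of_int \<epsilon>2 * of_int \<epsilon>2 = (1::real)" using e by auto
  have sc: "cos \<theta> * cos \<theta> + sin \<theta> * sin \<theta> = 1" by simp
  have iff: "?Q *v p \<in> torus_cyclide a c \<longleftrightarrow> p \<in> torus_cyclide a c" for p
  proof -
    have entries: "(?Q *v p) $ 1 = of_int \<epsilon>2 * (cos \<theta> * p $ 1 - sin \<theta> * p $ 2)"
      "(?Q *v p) $ 2 = sin \<theta> * p $ 1 + cos \<theta> * p $ 2"
      by (simp_all add: matrix_vector_mult_def sum_3 algebra_simps)
    have "((?Q *v p) $ 1)\<^sup>2 + ((?Q *v p) $ 2)\<^sup>2 = (p $ 1)\<^sup>2 + (p $ 2)\<^sup>2"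
      unfolding entries using sq(2) sc by algebra
    moreover have "((?Q *v p) $ 3)\<^sup>2 = (p $ 3)\<^sup>2"
      using e by (auto simp: matrix_vector_mult_def sum_3)
    ultimately show ?thesis by (simp add: torus_cyclide_def)
  qed
  have "?Q ** transpose ?Q = mat 1" using orthogonal_Q_form[OF e] by (simp add: orthogonal_matrix_def)
  then have inv: "?Q *v (transpose ?Q *v p) = p" for p
    by (simp add: matrix_vector_mul_assoc del: transpose_matrix_vector)
  show ?thesis
    unfolding affine_map_def using iff inv by (auto simp: image_iff) metis
qed

theorem torus_symmetry_iff:
  assumes "a \<noteq> 0" and "orthogonal_matrix Q"
  shows "affine_map Q b ` torus_cyclide a c = torus_cyclide a c \<longleftrightarrow>
    (\<exists>\<epsilon>1\<in>{-1, 1}. \<exists>\<epsilon>2\<in>{-1, 1}. \<exists>\<theta>\<in>{0..<2 * pi}. Q = Q_form \<epsilon>1 \<epsilon>2 \<theta> \<and> b = 0)"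
proof
  assume "affine_map Q b ` torus_cyclide a c = torus_cyclide a c"
  note axis = torus_symmetry_imp_axis_preserving[OF assms this]
  show "\<exists>\<epsilon>1\<in>{-1, 1}. \<exists>\<epsilon>2\<in>{-1, 1}. \<exists>\<theta>\<in>{0..<2 * pi}. Q = Q_form \<epsilon>1 \<epsilon>2 \<theta> \<and> b = 0"
    using orthogonal_axis_preserving_imp_Q_form[OF assms(2) axis(2,3)] axis(1) by simp
next
  assume "\<exists>\<epsilon>1\<in>{-1, 1}. \<exists>\<epsilon>2\<in>{-1, 1}. \<exists>\<theta>\<in>{0..<2 * pi}. Q = Q_form \<epsilon>1 \<epsilon>2 \<theta> \<and> b = 0"
  then obtain \<epsilon>1 \<epsilon>2 \<theta> where e: "\<epsilon>1 \<in> {-1, 1}" "\<epsilon>2 \<in> {-1, 1}" and "Q = Q_form \<epsilon>1 \<epsilon>2 \<theta>" "b = 0"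
    by blast
  then show "affine_map Q b ` torus_cyclide a c = torus_cyclide a c"
    using Q_form_preserves_torus[OF e] by simp
qed

section \<open>The symmetry group\<close>

lemma affine_map_comp:
  "affine_map Q b \<circ> affine_map Q' b' = affine_map (Q ** Q') (Q *v b' + b)"
  by (auto simp: affine_map_def fun_eq_iff matrix_vector_mul_assoc matrix_vector_right_distrib)

lemma affine_map_id: "affine_map (mat 1) 0 = id"
  by (auto simp: affine_map_def)

lemma group_symmetry_group: "group (symmetry_group S)"
proof (rule groupI)
  fix f g assume "f \<in> carrier (symmetry_group S)" "g \<in> carrier (symmetry_group S)"
  then obtain Q b Q' b' where fg: "orthogonal_matrix Q" "orthogonal_matrix Q'"
    "f = affine_map Q b" "g = affine_map Q' b'" "f ` S = S" "g ` S = S"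
    by (auto simp: symmetry_group_def)
  have "(f \<circ> g) ` S = S" by (simp only: fg(5,6) flip: image_comp)
  moreover have "orthogonal_matrix (Q ** Q')" using fg by (simp add: orthogonal_matrix_mul)
  ultimately show "f \<otimes>\<^bsub>symmetry_group S\<^esub> g \<in> carrier (symmetry_group S)"
    using fg(3,4) affine_map_comp by (auto simp: symmetry_group_def)
next
  show "\<one>\<^bsub>symmetry_group S\<^esub> \<in> carrier (symmetry_group S)"
    using affine_map_id[symmetric] orthogonal_matrix_id
    by (simp add: symmetry_group_def) blast
next
  fix f assume "f \<in> carrier (symmetry_group S)"
  then obtain Q b where f: "orthogonal_matrix Q" "f = affine_map Q b" "f ` S = S"
    by (auto simp: symmetry_group_def)
  define g where "g = affine_map (transpose Q) (- (transpose Q *v b))"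
  have id: "g \<circ> f = id"
    using f(1) affine_map_id by (simp add: f(2) g_def affine_map_comp orthogonal_matrix)
  have "g ` S = g ` (f ` S)" by (simp only: f(3))
  also have "\<dots> = (g \<circ> f) ` S" by (rule image_comp)
  finally have img: "g ` S = S" by (simp only: id image_id id_apply)
  have "orthogonal_matrix (transpose Q)" using f(1) by (simp only: orthogonal_matrix_transpose)
  then have "\<exists>P d. orthogonal_matrix P \<and> g = affine_map P d" unfolding g_def by blast
  then have "g \<in> carrier (symmetry_group S)"
    using img by (simp add: symmetry_group_def)
  with id show "\<exists>g\<in>carrier (symmetry_group S). g \<otimes>\<^bsub>symmetry_group S\<^esub> f = \<one>\<^bsub>symmetry_group S\<^esub>"
    by (intro bexI[of _ g]) (simp_all add: symmetry_group_def)
qed (auto simp: symmetry_group_def o_assoc)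

lemma group_O3: "group O3"
proof (rule groupI)
  fix Q assume "Q \<in> carrier O3"
  then show "\<exists>P\<in>carrier O3. P \<otimes>\<^bsub>O3\<^esub> Q = \<one>\<^bsub>O3\<^esub>"
    by (intro bexI[of _ "transpose Q"])
       (auto simp: O3_def orthogonal_matrix_def)
qed (auto simp: O3_def orthogonal_matrix_mul orthogonal_matrix_id matrix_mul_assoc)

lemma inv_O3: "Q \<in> carrier O3 \<Longrightarrow> inv\<^bsub>O3\<^esub> Q = transpose Q"
  by (rule group.inv_equality[OF group_O3])
     (auto simp: O3_def orthogonal_matrix_def)

lemma mult_axis3_eq_iff:
  fixes Q :: "real ^ 3 ^ 3"
  shows "Q *v axis 3 1 = axis 3 1 \<longleftrightarrow> Q $ 1 $ 3 = 0 \<and> Q $ 2 $ 3 = 0 \<and> Q $ 3 $ 3 = 1"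
  by (simp add: vec_eq_iff forall_3 matrix_vector_mult_def sum_3 axis_def)

lemma orthogonal_stabiliser_imp_Q_form:
  fixes Q :: "real ^ 3 ^ 3"
  assumes "orthogonal_matrix Q" "Q *v axis 3 1 = axis 3 1"
  obtains \<epsilon>2 \<theta> where "\<epsilon>2 \<in> {-1, 1}" "Q = Q_form 1 \<epsilon>2 \<theta>"
proof -
  have z: "Q $ 1 $ 3 = 0" "Q $ 2 $ 3 = 0" "Q $ 3 $ 3 = 1"
    using assms(2) by (auto simp: mult_axis3_eq_iff)
  have "(Q $ 3 $ 1)\<^sup>2 + (Q $ 3 $ 2)\<^sup>2 = 0"
    using orthogonal_matrix_rows[OF assms(1), of 3 3] z by (simp add: power2_eq_square)
  then have "Q $ 3 $ 1 = 0" "Q $ 3 $ 2 = 0" by (auto simp: sum_power2_eq_zero_iff)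
  then obtain \<epsilon>1 \<epsilon>2 \<theta> where Q: "\<epsilon>2 \<in> {-1, 1}" "Q = Q_form \<epsilon>1 \<epsilon>2 \<theta>"
    using orthogonal_axis_preserving_imp_Q_form[OF assms(1)] by blast
  then have "\<epsilon>1 = 1" using z(3) by simp
  with Q that show thesis by blast
qed

lemma matrix_plane_reflection:
  "matrix (plane_reflection n) $ i $ j = (if i = j then 1 else 0) - 2 * n $ i * n $ j"
  by (simp add: matrix_def plane_reflection_def axis_def inner_vec_def if_distrib cong: if_cong)

text \<open>
  This description turns closure under products and inverses into a triviality. For the inclusion
  from right to left, a stabiliser element of determinant \<open>-1\<close> is the reflection whose unit normal
  has half the angle of the matrix, by the double-angle formulas.
\<close>

lemma z_subgroup_eq_stabiliser:
  "z_subgroup = {Q. orthogonal_matrix Q \<and> Q *v axis 3 1 = axis 3 1}"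
proof (intro equalityI subsetI)
  fix Q assume "Q \<in> z_subgroup"
  then consider "Q \<in> z_rotations" | "Q \<in> z_reflections" by (auto simp: z_subgroup_def)
  then show "Q \<in> {Q. orthogonal_matrix Q \<and> Q *v axis 3 1 = axis 3 1}"
  proof cases
    case 1
    then show ?thesis by (auto simp: z_rotations_def rotation_matrix_def)
  next
    case 2
    then obtain n :: "real^3" where n: "norm n = 1" "n \<bullet> axis 3 1 = 0"
      and Q: "Q = matrix (plane_reflection n)" by (auto simp: z_reflections_def)
    have n3: "n $ 3 = 0" using n(2) by (simp add: inner_axis)
    have n12: "n $ 1 * n $ 1 + n $ 2 * n $ 2 = 1"
      using n(1) n3 norm_vec3[of n] by (simp add: power2_eq_square)
    have "orthogonal_matrix Q"
      unfolding orthogonal_matrix Q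
      by (simp add: vec_eq_iff forall_3 matrix_matrix_mult_def transpose_def mat_def sum_3
            matrix_plane_reflection n3)
         (use n12 in \<open>intro conjI; algebra\<close>)
    moreover have "Q *v axis 3 1 = axis 3 1"
      by (simp add: mult_axis3_eq_iff Q matrix_plane_reflection n3)
    ultimately show ?thesis by simp
  qed
next
  fix Q :: "real^3^3" assume "Q \<in> {Q. orthogonal_matrix Q \<and> Q *v axis 3 1 = axis 3 1}"
  then have Q: "orthogonal_matrix Q" "Q *v axis 3 1 = axis 3 1" by auto
  then obtain \<epsilon>2 \<theta> where e: "\<epsilon>2 \<in> {-1, 1}" and form: "Q = Q_form 1 \<epsilon>2 \<theta>"
    by (rule orthogonal_stabiliser_imp_Q_form)
  from e consider "\<epsilon>2 = 1" | "\<epsilon>2 = -1" by blast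
  then show "Q \<in> z_subgroup"
  proof cases
    case 1
    then have "det Q = 1" using sin_cos_squared_add3[of \<theta>] by (simp add: det_3 form)
    then show ?thesis using Q by (auto simp: z_subgroup_def z_rotations_def rotation_matrix_def)
  next
    case 2
    define n :: "real^3" where "n = vector [cos (\<theta> / 2), - sin (\<theta> / 2), 0]"
    have n: "n $ 1 = cos (\<theta> / 2)" "n $ 2 = - sin (\<theta> / 2)" "n $ 3 = 0" by (simp_all add: n_def)
    have "(norm n)\<^sup>2 = 1" by (simp add: norm_vec3 n)
    then have "norm n = 1" using power2_eq_imp_eq[of "norm n" 1] by simp
    moreover have "n \<bullet> axis 3 1 = 0" by (simp add: inner_axis n)
    moreover have "Q = matrix (plane_reflection n)"
      using cos_double_cos[of "\<theta> / 2"] cos_double_sin[of "\<theta> / 2"] sin_double[of "\<theta> / 2"]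
      by (simp add: vec_eq_iff forall_3 matrix_plane_reflection n form 2 power2_eq_square)
    ultimately show ?thesis by (auto simp: z_subgroup_def z_reflections_def)
  qed
qed

lemma z_subgroup_cases:
  assumes "P \<in> z_subgroup"
  obtains \<epsilon>2 \<theta> where "\<epsilon>2 \<in> {-1, 1}" "P = Q_form 1 \<epsilon>2 \<theta>"
proof -
  have "orthogonal_matrix P" "P *v axis 3 1 = axis 3 1"
    using assms by (simp_all add: z_subgroup_eq_stabiliser)
  then show thesis by (rule orthogonal_stabiliser_imp_Q_form) (rule that)
qed

lemma subgroup_z_subgroup: "subgroup z_subgroup O3"
proof (rule group.subgroupI[OF group_O3])
  show "z_subgroup \<subseteq> carrier O3" by (auto simp: z_subgroup_eq_stabiliser O3_def)
  have "mat 1 \<in> z_subgroup" by (simp add: z_subgroup_eq_stabiliser orthogonal_matrix_id)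
  then show "z_subgroup \<noteq> {}" by blast
next
  fix Q assume Q: "Q \<in> z_subgroup"
  then have orth: "orthogonal_matrix Q" and fixed: "Q *v axis 3 1 = axis 3 1"
    by (auto simp: z_subgroup_eq_stabiliser)
  have "transpose Q *v axis 3 1 = transpose Q *v (Q *v axis 3 1)" by (simp only: fixed)
  also have "\<dots> = axis 3 1"
    using orth by (simp add: matrix_vector_mul_assoc orthogonal_matrix del: transpose_matrix_vector)
  finally have "transpose Q \<in> z_subgroup"
    using orth by (simp add: z_subgroup_eq_stabiliser orthogonal_matrix_transpose)
  moreover have "inv\<^bsub>O3\<^esub> Q = transpose Q" using orth by (intro inv_O3) (simp add: O3_def)
  ultimately show "inv\<^bsub>O3\<^esub> Q \<in> z_subgroup" by simp
next
  fix P Q assume "P \<in> z_subgroup" "Q \<in> z_subgroup"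
  then show "P \<otimes>\<^bsub>O3\<^esub> Q \<in> z_subgroup"
    by (auto simp: O3_def z_subgroup_eq_stabiliser orthogonal_matrix_mul
        simp flip: matrix_vector_mul_assoc)
qed

lemma Q_form_stabiliser: "\<epsilon>2 \<in> {-1, 1} \<Longrightarrow> Q_form 1 \<epsilon>2 \<theta> \<in> z_subgroup"
  by (simp add: z_subgroup_eq_stabiliser orthogonal_Q_form mult_axis3_eq_iff)

lemma Q_form_in_symmetry_group:
  assumes e: "\<epsilon>1 \<in> {-1, 1}" "\<epsilon>2 \<in> {-1, 1}"
  shows "affine_map (Q_form \<epsilon>1 \<epsilon>2 \<theta>) 0 \<in> carrier (symmetry_group (torus_cyclide a c))"
proof -
  have "\<exists>Q b. orthogonal_matrix Q \<and> affine_map (Q_form \<epsilon>1 \<epsilon>2 \<theta>) 0 = affine_map Q b"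
    using orthogonal_Q_form[OF e] by blast
  then show ?thesis
    using Q_form_preserves_torus[OF e] by (simp add: symmetry_group_def)
qed

lemma carrier_symmetry_group_torus:
  assumes "a \<noteq> 0"
  shows "carrier (symmetry_group (torus_cyclide a c)) =
    {affine_map (Q_form \<epsilon>1 \<epsilon>2 \<theta>) 0 |\<epsilon>1 \<epsilon>2 \<theta>.
       \<epsilon>1 \<in> {-1, 1} \<and> \<epsilon>2 \<in> {-1, 1} \<and> \<theta> \<in> {0..<2 * pi}}" (is "?L = ?R")
proof (intro equalityI subsetI)
  fix f assume "f \<in> ?L"
  then obtain Q b where orth: "orthogonal_matrix Q" and f: "f = affine_map Q b"
    and inv: "affine_map Q b ` torus_cyclide a c = torus_cyclide a c"
    by (auto simp: symmetry_group_def)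
  from inv[unfolded torus_symmetry_iff[OF assms orth]] obtain \<epsilon>1 \<epsilon>2 \<theta>
    where "\<epsilon>1 \<in> {-1, 1}" "\<epsilon>2 \<in> {-1, 1}" "\<theta> \<in> {0..<2 * pi}" "Q = Q_form \<epsilon>1 \<epsilon>2 \<theta>" "b = 0"
    by (elim bexE conjE)
  with f show "f \<in> ?R" by blast
next
  fix f assume "f \<in> ?R"
  then obtain \<epsilon>1 \<epsilon>2 \<theta> where e: "\<epsilon>1 \<in> {-1, 1}" "\<epsilon>2 \<in> {-1, 1}"
    and f: "f = affine_map (Q_form \<epsilon>1 \<epsilon>2 \<theta>) 0"
    by blast
  show "f \<in> ?L" unfolding f by (rule Q_form_in_symmetry_group[OF e])
qed

text \<open>
  The reflection in the plane \<open>z = 0\<close> or the identity, depending on the parity of \<open>k\<close>; the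
  integer argument matches the carrier of the cyclic group of order two.
\<close>

definition z_flip :: "int \<Rightarrow> real ^ 3 ^ 3" where
  "z_flip k = vector [vector [1, 0, 0], vector [0, 1, 0], vector [0, 0, (-1) powi k]]"

lemma z_flip_entries [simp]:
  "z_flip k $ 1 $ 1 = 1" "z_flip k $ 1 $ 2 = 0" "z_flip k $ 1 $ 3 = 0"
  "z_flip k $ 2 $ 1 = 0" "z_flip k $ 2 $ 2 = 1" "z_flip k $ 2 $ 3 = 0"
  "z_flip k $ 3 $ 1 = 0" "z_flip k $ 3 $ 2 = 0" "z_flip k $ 3 $ 3 = (-1) powi k"
  by (simp_all add: z_flip_def)

lemma z_flip_mult_nth:
  "(z_flip k ** A) $ i $ j = (if i = 3 then (-1) powi k else 1) * A $ i $ j"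
  using exhaust_3[of i] by (auto simp: matrix_matrix_mult_def sum_3)

text \<open>
  An element of the subgroup is block diagonal, and the flip is scalar on both blocks.
\<close>

lemma z_flip_commute:
  assumes "P \<in> z_subgroup"
  shows "z_flip k ** P = P ** z_flip k"
proof -
  obtain \<epsilon>2 \<theta> where "P = Q_form 1 \<epsilon>2 \<theta>" by (rule z_subgroup_cases[OF assms])
  then show ?thesis
    by (simp add: vec_eq_iff forall_3 matrix_matrix_mult_def sum_3)
qed

lemma z_flip_add_mod_2: "z_flip ((k + l) mod 2) = z_flip k ** z_flip l"
  by (simp add: vec_eq_iff forall_3 matrix_matrix_mult_def sum_3 power_int_minus_left)

lemma z_flip_Q_form: "z_flip k ** Q_form 1 \<epsilon>2 \<theta> = Q_form (if even k then 1 else -1) \<epsilon>2 \<theta>"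
  by (simp add: vec_eq_iff forall_3 z_flip_mult_nth power_int_minus_left)

lemma affine_map_0_eq_iff: "affine_map A 0 = affine_map B 0 \<longleftrightarrow> A = B"
  by (auto simp: affine_map_def fun_eq_iff matrix_eq)

text \<open>
  The map is multiplicative because the flip is central. The entry in the lower right corner
  recovers \<open>k\<close>, hence it is injective, and it is onto because
  \<open>Q_form \<epsilon>1 \<epsilon>2 \<theta>\<close> is a flip times \<open>Q_form 1 \<epsilon>2 \<theta>\<close>.
\<close>

lemma iso_symmetry_group_torus:
  fixes a c :: real
  assumes a: "a \<noteq> 0"
  defines "G \<equiv> integer_mod_group 2 \<times>\<times> (O3\<lparr>carrier := z_subgroup\<rparr>)"
    and "H \<equiv> symmetry_group (torus_cyclide a c)"
  shows "(\<lambda>(k, P). affine_map (z_flip k ** P) 0) \<in> iso G H"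
proof (rule isoI)
  let ?h = "\<lambda>(k, P). affine_map (z_flip k ** P) 0"
  have carr: "carrier G = {0, 1} \<times> z_subgroup"
  proof -
    have "{0..<2::int} = {0, 1}" by auto
    then show ?thesis by (simp add: G_def DirProd_def carrier_integer_mod_group)
  qed
  have into: "affine_map (z_flip k ** P) 0 \<in> carrier H" if P: "P \<in> z_subgroup" for k P
  proof -
    obtain \<epsilon>2 \<theta> where e: "\<epsilon>2 \<in> {-1, 1}" and P: "P = Q_form 1 \<epsilon>2 \<theta>"
      by (rule z_subgroup_cases[OF P])
    have s: "(if even k then 1 else -1) \<in> {-1, 1 :: int}" by simp
    show ?thesis
      unfolding P z_flip_Q_form H_def by (rule Q_form_in_symmetry_group[OF s e])
  qed
  show "?h \<in> hom G H"
  proof (rule homI)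
    fix x assume "x \<in> carrier G"
    then show "?h x \<in> carrier H" using into by (auto simp: carr)
  next
    fix x y assume "x \<in> carrier G" "y \<in> carrier G"
    then obtain k P l Q where xy: "x = (k, P)" "y = (l, Q)" "P \<in> z_subgroup" "Q \<in> z_subgroup"
      by (auto simp: carr)
    have "x \<otimes>\<^bsub>G\<^esub> y = ((k + l) mod 2, P ** Q)"
      by (simp add: G_def DirProd_def xy O3_def mult_integer_mod_group)
    moreover have "(z_flip k ** z_flip l) ** (P ** Q) = (z_flip k ** P) ** (z_flip l ** Q)"
      using z_flip_commute[OF xy(3)] by (metis matrix_mul_assoc)
    ultimately show "?h (x \<otimes>\<^bsub>G\<^esub> y) = ?h x \<otimes>\<^bsub>H\<^esub> ?h y"
      by (simp add: xy H_def symmetry_group_def affine_map_comp z_flip_add_mod_2)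
  qed
  show "bij_betw ?h (carrier G) (carrier H)"
  proof (rule bij_betw_imageI)
    show "inj_on ?h (carrier G)"
    proof (rule inj_onI)
      fix x y assume x: "x \<in> carrier G" and y: "y \<in> carrier G" and eq: "?h x = ?h y"
      obtain k P where xP: "x = (k, P)" "k \<in> {0, 1}" "P \<in> z_subgroup" using x by (auto simp: carr)
      obtain l Q where yQ: "y = (l, Q)" "l \<in> {0, 1}" "Q \<in> z_subgroup" using y by (auto simp: carr)
      have eq: "z_flip k ** P = z_flip l ** Q" using eq by (simp add: xP(1) yQ(1) affine_map_0_eq_iff)
      then have "(z_flip k ** P) $ 3 $ 3 = (z_flip l ** Q) $ 3 $ 3" by simp
      then have "k = l"
        using xP yQ by (auto simp: z_flip_mult_nth z_subgroup_eq_stabiliser mult_axis3_eq_iff)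
      moreover from this eq have "P $ i $ j = Q $ i $ j" for i j
        using z_flip_mult_nth[of k P i j] z_flip_mult_nth[of l Q i j] by (auto split: if_splits)
      ultimately show "x = y" using xP yQ by (simp add: vec_eq_iff)
    qed
    show "?h ` carrier G = carrier H"
    proof (intro equalityI subsetI)
      fix f assume "f \<in> ?h ` carrier G"
      then show "f \<in> carrier H" using into by (auto simp: carr)
    next
      fix f assume "f \<in> carrier H"
      then obtain \<epsilon>1 \<epsilon>2 \<theta> where e: "\<epsilon>1 \<in> {-1, 1}" "\<epsilon>2 \<in> {-1, 1}"
        and f: "f = affine_map (Q_form \<epsilon>1 \<epsilon>2 \<theta>) 0"
        unfolding H_def carrier_symmetry_group_torus[OF a] by blast
      define k :: int where "k = (if \<epsilon>1 = 1 then 0 else 1)"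
      have "f = ?h (k, Q_form 1 \<epsilon>2 \<theta>)" using e by (auto simp: f z_flip_Q_form k_def)
      moreover have "(k, Q_form 1 \<epsilon>2 \<theta>) \<in> carrier G"
        using Q_form_stabiliser[OF e(2)] by (simp add: carr k_def)
      ultimately show "f \<in> ?h ` carrier G" by blast
    qed
  qed
qed

theorem theorem12:
  fixes a c :: real
  assumes "a \<noteq> 0" and "c \<noteq> 0"
  shows
    "(\<forall>Q b. orthogonal_matrix Q \<longrightarrow>
        (affine_map Q b ` torus_cyclide a c = torus_cyclide a c \<longleftrightarrow>
          (\<exists>\<phi>1 \<phi>2. moebius_ratfun \<phi>1 \<and> moebius_ratfun \<phi>2 \<and> condA1 a Q b \<phi>1 \<phi>2 \<and> condA2 a c \<phi>1 \<phi>2)))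
     \<and> (\<forall>Q b \<phi>1 \<phi>2. orthogonal_matrix Q \<longrightarrow>
        (moebius_ratfun \<phi>1 \<and> moebius_ratfun \<phi>2 \<and> condA1 a Q b \<phi>1 \<phi>2 \<and> condA2 a c \<phi>1 \<phi>2 \<longleftrightarrow>
          (\<exists>\<epsilon>1\<in>{-1, 1}. \<exists>\<epsilon>2\<in>{-1, 1}. \<exists>\<theta>\<in>{0..<2 * pi}.
             \<phi>1 = phi1_form \<epsilon>2 \<theta> \<and> \<phi>2 = phi2_form \<epsilon>1 \<and> Q = Q_form \<epsilon>1 \<epsilon>2 \<theta> \<and> b = 0)))
     \<and> carrier (symmetry_group (torus_cyclide a c)) =
        {affine_map (Q_form \<epsilon>1 \<epsilon>2 \<theta>) 0 |\<epsilon>1 \<epsilon>2 \<theta>.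
           \<epsilon>1 \<in> {-1, 1} \<and> \<epsilon>2 \<in> {-1, 1} \<and> \<theta> \<in> {0..<2 * pi}}
     \<and> group (symmetry_group (torus_cyclide a c))
     \<and> subgroup z_subgroup O3
     \<and> symmetry_group (torus_cyclide a c) \<cong>
        integer_mod_group 2 \<times>\<times> (O3\<lparr>carrier := z_subgroup\<rparr>)"
proof -
  note symm = torus_symmetry_iff[OF assms(1)] and moeb = moebius_conditions_iff[OF assms]
  have "group (integer_mod_group 2 \<times>\<times> (O3\<lparr>carrier := z_subgroup\<rparr>))"
    by (intro DirProd_group group_integer_mod_group subgroup.subgroup_is_group
        subgroup_z_subgroup group_O3)
  then have iso: "symmetry_group (torus_cyclide a c) \<cong>
      integer_mod_group 2 \<times>\<times> (O3\<lparr>carrier := z_subgroup\<rparr>)"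
    using iso_symmetry_group_torus[OF assms(1)] group.iso_sym is_isoI by blast
  have symm_iff_moeb: "affine_map Q b ` torus_cyclide a c = torus_cyclide a c \<longleftrightarrow>
      (\<exists>\<phi>1 \<phi>2. moebius_ratfun \<phi>1 \<and> moebius_ratfun \<phi>2 \<and> condA1 a Q b \<phi>1 \<phi>2 \<and> condA2 a c \<phi>1 \<phi>2)"
    (is "?sym \<longleftrightarrow> ?ex") if orth: "orthogonal_matrix Q" for Q b
  proof
    assume ?sym
    then obtain \<epsilon>1 \<epsilon>2 \<theta> where "\<epsilon>1 \<in> {-1, 1}" "\<epsilon>2 \<in> {-1, 1}" "\<theta> \<in> {0..<2 * pi}"
      "Q = Q_form \<epsilon>1 \<epsilon>2 \<theta>" "b = 0"
      unfolding symm[OF orth] by (elim bexE conjE)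
    then show ?ex
      unfolding moeb[OF orth]
      by (intro exI[of _ "phi1_form \<epsilon>2 \<theta>"] exI[of _ "phi2_form \<epsilon>1"] bexI[of _ \<epsilon>1] bexI[of _ \<epsilon>2]
          bexI[of _ \<theta>] conjI refl)
  next
    assume ?ex
    then obtain \<epsilon>1 \<epsilon>2 \<theta> where "\<epsilon>1 \<in> {-1, 1}" "\<epsilon>2 \<in> {-1, 1}" "\<theta> \<in> {0..<2 * pi}"
      "Q = Q_form \<epsilon>1 \<epsilon>2 \<theta>" "b = 0"
      unfolding moeb[OF orth] by (elim exE bexE conjE)
    then show ?sym
      unfolding symm[OF orth]
      by (intro bexI[of _ \<epsilon>1] bexI[of _ \<epsilon>2] bexI[of _ \<theta>] conjI)
  qed
  show ?thesis
    by (intro conjI allI impI symm_iff_moeb moeb carrier_symmetry_group_torus[OF assms(1)]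
        group_symmetry_group subgroup_z_subgroup iso; assumption)
qed

end
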